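(* Consider the marginal canonical measure (the marginal in $\boldsymbol b^\pm$ of the canonical measure) for the quadratic Hamiltonian approximation $$H_N\approx E_N^\pm+\sum_{j=1}^N\Big(\frac{1}{2N}\tilde p_j^2+\frac12\lambda_j^\pm (b_j^\pm)^2\Big),$$ and the $N$-dimensional box with side edge lengths $2\delta_j$, $$D_\delta^N=\{\boldsymbol b^\pm\in\mathbb{R}^N:\ -\delta_j\le b_j^\pm\le\delta_j\ \ \text{for all } j=1,\dots,N\},$$ where the $\delta_j$ are such that $\sum_{j=1}^N\delta_j^2$ converges as $N\to\infty$. Assume that the eigenvalues $\lambda_j^\pm$ of the discretized Hessian at $\boldsymbol u^\pm$, i.e. those solving $$\lambda_k^\pm\psi_j^{(k)\pm}=-\delta^2N^2\big(\psi_{j-1}^{(k)\pm}-2\psi_j^{(k)\pm}+\psi_{j+1}^{(k)\pm}\big)+V''(u_j^\pm)\psi_j^{(k)\pm},\qquad j=1,\dots,N,$$ with the appropriate boundary conditions fixing $\psi_0^{(k)\pm}$ and $\psi_{N+1}^{(k)\pm}$, satisfy $$\lambda_j^\pm\sim Cj^2\quad\text{as } j\to\infty,\ \text{for some } C>0.$$ Then, for every $\hat\delta>0$, there exist $\beta_1>0$ and a set $\{\delta_j\}_{j=1}^N$ such that for every $\beta>\beta_1$ and every $N>0$, $$\frac{\displaystyle\int_{D_\delta^N}\exp\Big(-\frac{\beta}{2}\sum_{j=1}^N\lambda_j^\pm(b_j^\pm)^2\Big)\,d\boldsymbol b^\pm}{\displaystyle\int_{\mathbb{R}^N}\exp\Big(-\frac{\beta}{2}\sum_{j=1}^N\lambda_j^\pm(b_j^\pm)^2\Big)\,d\boldsymbol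 b^\pm}>1-\hat\delta.$$
   Context: Setting: the wave equation $u_{tt}-\delta^2u_{xx}+V'(u)=0$ on $[0,1]$ with Dirichlet or Neumann boundary conditions, where $\delta>0$ is a fixed parameter (distinct from the box half-widths $\delta_j$ and from $\hat\delta$) and $V$ is a double-well potential, bounded below and growing at least like $u^2$ as $|u|\to\infty$ (e.g. $V(u)=\frac14(1-u^2)^2$). It is discretized at $x_j=j/(N+1)$, with $\boldsymbol u=(u_1,\dots,u_N)$, $\boldsymbol p=(p_1,\dots,p_N)$, and Hamiltonian $$H_N(\boldsymbol p,\boldsymbol u)=\frac1{2N}\sum_{j=1}^Np_j^2+U_N(\boldsymbol u),\qquad U_N(\boldsymbol u)=\frac1N\sum_{j=1}^NV(u_j)+N\sum_{j=0}^N\tfrac12\delta^2(u_{j+1}-u_j)^2,$$ where $u_0,u_{N+1}$ are fixed by the boundary conditions ($u_0=u_{N+1}=0$ for Dirichlet; $u_0=u_1$, $u_{N+1}=u_N$ for Neumann; likewise for the eigenvectors $\boldsymbol\psi^{(k)\pm}$). The canonical measure at inverse temperature $\beta>0$ is proportional to $e^{-\beta H_N(\boldsymbol p,\boldsymbol u)}d\boldsymbol p\,d\boldsymbol u$. The points $\boldsymbol u^+$ and $\boldsymbol u^-$ are the two minimizers of the potential energy $U_N$, and $E_N^\pm=U_N(\boldsymbol u^\pm)$. The eigenvalues are all positive and numbered so that $\lambda_j^\pm<\lambda_k^\pm$ for $j<k$; the eigenvectors $\boldsymbol\psi^{(k)\pm}=(\psi_1^{(k)\pm},\dots,\psi_N^{(k)\pm})$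 are normalized by $\frac1N\sum_{j=1}^N(\psi_j^{(k)\pm})^2=1$. The coordinates $\boldsymbol b^\pm=(b_1^\pm,\dots,b_N^\pm)$ are defined by $\boldsymbol u=\boldsymbol u^\pm+\sum_{k=1}^Nb_k^\pm\boldsymbol\psi^{(k)\pm}$, and $\tilde p_j$ denote the correspondingly rotated momenta; the quadratic Hamiltonian is the approximation of $H_N$ as $\boldsymbol u\to\boldsymbol u^\pm$. The statement holds for each choice of sign $\pm$.
   Formalization: The eigenvalues are assumed bounded below by a positive constant independent of N, not merely positive for each N; otherwise the claim fails, e.g. for V=(1-u^2)^2/4, Dirichlet conditions, δ=1/π, where the lowest eigenvalue tends to 0 as N grows. *)

theory Defs
  imports "HOL-Analysis.Analysis"
begin

datatype boundary = Dirichlet | Neumann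

datatype well = Plus | Minus

text \<open>A vector with entries at the interior grid points \<open>1, \<dots>, N\<close> is a function
  \<open>nat \<Rightarrow> real\<close>, of which only the values on \<open>{1..N}\<close> matter; \<open>bdry_ext\<close> supplies the
  values at \<open>0\<close> and \<open>N + 1\<close> that the boundary condition dictates.\<close>

definition bdry_ext :: "boundary \<Rightarrow> nat \<Rightarrow> (nat \<Rightarrow> real) \<Rightarrow> nat \<Rightarrow> real" where
  "bdry_ext bc N w j =
     (if j \<in> {1..N} then w j
      else case bc of
        Dirichlet \<Rightarrow> 0
      | Neumann \<Rightarrow> (if j = 0 then w 1 else w N))"

definition double_well :: "(real \<Rightarrow> real) \<Rightarrow> bool" where
  "double_well V \<longleftrightarrow> (\<exists>a b. a < b \<and> {x. \<forall>\<^sub>F y in nhds x. V x \<le> V y} = {a, b})"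

definition potential_energy ::
  "(real \<Rightarrow> real) \<Rightarrow> real \<Rightarrow> boundary \<Rightarrow> nat \<Rightarrow> (nat \<Rightarrow> real) \<Rightarrow> real" where
  "potential_energy V \<delta> bc N u =
     1 / real N * (\<Sum>j=1..N. V (u j)) +
     real N * (\<Sum>j=0..N. 1 / 2 * \<delta>\<^sup>2 * (bdry_ext bc N u (j + 1) - bdry_ext bc N u j)\<^sup>2)"

text \<open>Minimizers are local, since the energies at the two minimizers may differ.\<close>

definition minimizer :: "nat \<Rightarrow> ((nat \<Rightarrow> real) \<Rightarrow> real) \<Rightarrow> (nat \<Rightarrow> real) \<Rightarrow> bool" where
  "minimizer N F u \<longleftrightarrow>
     (\<exists>\<epsilon>>0. \<forall>v. (\<forall>j\<in>{1..N}. \<bar>v j - u j\<bar> < \<epsilon>) \<longrightarrow> F u \<le> F v)"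

definition hessian_eigenpair ::
  "(real \<Rightarrow> real) \<Rightarrow> real \<Rightarrow> boundary \<Rightarrow> nat \<Rightarrow> (nat \<Rightarrow> real) \<Rightarrow> real \<Rightarrow> (nat \<Rightarrow> real) \<Rightarrow> bool" where
  "hessian_eigenpair V'' \<delta> bc N u \<mu> \<psi> \<longleftrightarrow>
     (\<forall>j\<in>{1..N}.
        \<mu> * \<psi> j =
          - \<delta>\<^sup>2 * (real N)\<^sup>2 *
              (bdry_ext bc N \<psi> (j - 1) - 2 * bdry_ext bc N \<psi> j + bdry_ext bc N \<psi> (j + 1))
          + V'' (u j) * \<psi> j) \<and>
     1 / real N * (\<Sum>j=1..N. (\<psi> j)\<^sup>2) = 1"

definition coord_box :: "(nat \<Rightarrow> real) \<Rightarrow> nat \<Rightarrow> (nat \<Rightarrow> real) set" where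
  "coord_box d N = (\<Pi>\<^sub>E j\<in>{1..N}. {- d j .. d j})"

text \<open>Lebesgue measure on the space of coordinate vectors \<open>(b\<^sub>1, \<dots>, b\<^sub>N)\<close>.\<close>

abbreviation lebesgue_N :: "nat \<Rightarrow> (nat \<Rightarrow> real) measure" where
  "lebesgue_N N \<equiv> Pi\<^sub>M {1..N} (\<lambda>_. lborel)"

end

theory Submission
  imports Defs "HOL-Probability.Distributions"
begin

text \<open>The asymptotics \<open>\<lambda>\<^sub>j \<sim> C j\<^sup>2\<close> is assumed only for each fixed large \<open>j\<close> as \<open>N\<close> grows, whereas the box
  needs a bound \<open>\<lambda>\<^sub>j \<ge> c j\<^sup>2\<close> uniform in \<open>N \<ge> j\<close>. This bound follows from the Hessian structure: a
  truncation argument bounds the minimizers, hence \<open>V''\<close> along them from below, uniformly in \<open>N\<close>, and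
  the min-max principle with a discrete Poincare inequality on blocks of length about \<open>N / j\<close>
  controls the discrete Laplacian. The ratio of integrals is then a product of one-dimensional
  Gaussian probabilities, estimated by \<open>\<Prod>(1 - p\<^sub>j) \<ge> 1 - \<Sum>p\<^sub>j\<close>.\<close>

section \<open>Underdetermined homogeneous linear systems\<close>

text \<open>Gaussian elimination by induction on the equations \<open>P\<close>: each equation costs
  at most one unknown. Later the unknowns are coefficients of eigenvectors and the equations demand
  zeros at grid points.\<close>

lemma homogeneous_system_nontrivial_solution:
  fixes f :: "'i \<Rightarrow> 'p \<Rightarrow> 'a::field"
  assumes "finite P" "finite I" "card P < card I"
  shows "\<exists>c. (\<exists>i\<in>I. c i \<noteq> 0) \<and> (\<forall>p\<in>P. (\<Sum>i\<in>I. c i * f i p) = 0)"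
  using assms
proof (induction P arbitrary: I f rule: finite_induct)
  case empty
  then obtain i where "i \<in> I"
    by fastforce
  then show ?case
    by (intro exI[of _ "\<lambda>_. 1"]) auto
next
  case (insert p P)
  show ?case
  proof (cases "\<forall>i\<in>I. f i p = 0")
    case True
    have "card P < card I"
      using insert by simp
    from insert.IH[OF insert.prems(1) this, of f] obtain c where
      "\<exists>i\<in>I. c i \<noteq> 0" "\<forall>q\<in>P. (\<Sum>i\<in>I. c i * f i q) = 0"
      by blast
    with True show ?thesis
      by (intro exI[of _ c]) auto
  next
    case False
    then obtain r where r: "r \<in> I" "f r p \<noteq> 0"
      by blast
    define J where "J = I - {r}"
    \<comment> \<open>The system that remains after equation \<open>p\<close> has eliminated the
      unknown \<open>r\<close>.\<close>
    define g where "g i q = f i q - f i p / f r p * f r q" for i q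
    have J: "finite J" "r \<notin> J" "I = insert r J" "card P < card J"
      using insert r by (auto simp: J_def)
    from insert.IH[OF J(1,4), of g] obtain c where c: "\<exists>i\<in>J. c i \<noteq> 0"
      "\<And>q. q \<in> P \<Longrightarrow> (\<Sum>i\<in>J. c i * g i q) = 0"
      by blast
    \<comment> \<open>Back substitution: the value of the unknown \<open>r\<close> that equation
      \<open>p\<close> forces.\<close>
    define s where "s = - (\<Sum>i\<in>J. c i * f i p) / f r p"
    have split: "(\<Sum>i\<in>I. (c(r := s)) i * f i q) = s * f r q + (\<Sum>i\<in>J. c i * f i q)" for q
    proof -
      have "(\<Sum>i\<in>J. (c(r := s)) i * f i q) = (\<Sum>i\<in>J. c i * f i q)"
        using J(2) by (intro sum.cong) auto
      then show ?thesis
        using J by simp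
    qed
    have "(\<Sum>i\<in>J. c i * g i q) = s * f r q + (\<Sum>i\<in>J. c i * f i q)" for q
    proof -
      have "(\<Sum>i\<in>J. c i * g i q)
          = (\<Sum>i\<in>J. c i * f i q) - (\<Sum>i\<in>J. c i * f i p) / f r p * f r q"
        by (simp add: g_def right_diff_distrib sum_subtractf sum_distrib_right sum_divide_distrib
            mult.assoc)
      then show ?thesis
        by (simp add: s_def)
    qed
    then have "\<forall>q\<in>P. (\<Sum>i\<in>I. (c(r := s)) i * f i q) = 0"
      using c(2) split by simp
    moreover have "(\<Sum>i\<in>I. (c(r := s)) i * f i p) = 0"
      unfolding split using r by (simp add: s_def)
    moreover have "\<exists>i\<in>I. (c(r := s)) i \<noteq> 0"
      using c(1) J by auto
    ultimately show ?thesis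
      by blast
  qed
qed

section \<open>Bounds on the minimizers, uniform in the number of grid points\<close>

text \<open>If V failed to increase from \<open>x\<close> to \<open>y\<close> but rose again at some
  \<open>z > y\<close>, its minimum over [x, z] would be attained in the interior, giving a local
  minimum to the right of \<open>b\<close>.\<close>

lemma strict_increasing_right_of_local_minima:
  fixes V :: "real \<Rightarrow> real"
  assumes cont: "continuous_on UNIV V"
    and no_min: "\<And>x. x > b \<Longrightarrow> \<not> (\<forall>\<^sub>F y in nhds x. V x \<le> V y)"
    and unbounded: "\<And>x. \<exists>z>x. V z > V x"
    and xy: "b \<le> x" "x < y"
  shows "V x < V y"
proof (rule ccontr)
  assume "\<not> V x < V y"
  then have le: "V y \<le> V x" by simp
  obtain z where z: "z > y" "V z > V y"
    using unbounded by blast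
  obtain t where t: "t \<in> {x..z}" and tmin: "\<And>w. w \<in> {x..z} \<Longrightarrow> V t \<le> V w"
    using continuous_attains_inf[of "{x..z}" V] continuous_on_subset[OF cont] xy z by force
  \<comment> \<open>A minimum at the left endpoint can be moved to \<open>y\<close>, because V y <=
    V x. The right endpoint is excluded by V z > V y.\<close>
  define r where "r = (if t = x then y else t)"
  have ty: "V t \<le> V y"
    using tmin[of y] xy z by simp
  have "V r \<le> V w" if "w \<in> {x..z}" for w
    using tmin[OF that] le ty by (auto simp: r_def)
  moreover have r: "r \<in> {x<..<z}"
    using t ty z xy by (auto simp: r_def order_le_less)
  moreover have "\<forall>\<^sub>F w in nhds r. w \<in> {x<..<z}"
    using r by (intro eventually_nhds_in_open) auto
  ultimately have "\<forall>\<^sub>F w in nhds r. V r \<le> V w"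
    by (auto elim!: eventually_mono)
  then show False
    using no_min[of r] r xy by auto
qed

text \<open>The condition 0 <= t keeps truncation compatible with the Dirichlet boundary value
  0.\<close>

lemma bdry_ext_min:
  assumes "0 \<le> t" "N > 0"
  shows "bdry_ext bc N (\<lambda>j. min (u j) t) i = min (bdry_ext bc N u i) t"
  using assms by (auto simp: bdry_ext_def split: boundary.split)

text \<open>Truncating a local minimizer slightly below its maximum would lower the energy.\<close>

lemma minimizer_le:
  assumes min: "minimizer N (potential_energy V \<delta> bc N) u"
    and "N > 0" "B \<ge> 0"
    and incr: "\<And>x y. B \<le> x \<Longrightarrow> x < y \<Longrightarrow> V x < V y"
    and "j \<in> {1..N}"
  shows "u j \<le> B"
proof (rule ccontr)
  assume "\<not> u j \<le> B"
  define M where "M = Max (u ` {1..N})"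
  have uM: "u i \<le> M" if "i \<in> {1..N}" for i
    unfolding M_def using that by (intro Max_ge) auto
  have "M \<in> u ` {1..N}"
    unfolding M_def using assms by (intro Max_in) auto
  then obtain k where k: "k \<in> {1..N}" "u k = M"
    by auto
  have "B < M"
    using uM[of j] assms \<open>\<not> u j \<le> B\<close> by simp
  from min obtain e where e: "e > 0" and
    emin: "\<And>v. (\<forall>j\<in>{1..N}. \<bar>v j - u j\<bar> < e) \<Longrightarrow>
      potential_energy V \<delta> bc N u \<le> potential_energy V \<delta> bc N v"
    unfolding minimizer_def by blast
  \<comment> \<open>The level is within \<open>e / 2\<close> of the maximum, so truncation stays in
    the neighbourhood where \<open>u\<close> is minimal. It is at least \<open>B\<close>, so V
    strictly decreases wherever truncation acts, and below \<open>M\<close>, so truncation acts at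
    \<open>k\<close>.\<close>
  define t where "t = max B (M - e / 2)"
  have t: "B \<le> t" "t < M" "0 \<le> t" "M < t + e"
    using e \<open>B < M\<close> assms by (auto simp: t_def)
  define v where "v i = min (u i) t" for i
  have "\<bar>v i - u i\<bar> < e" if "i \<in> {1..N}" for i
    using uM[OF that] t e by (auto simp: v_def)
  then have energy: "potential_energy V \<delta> bc N u \<le> potential_energy V \<delta> bc N v"
    using emin by blast
  have "(\<Sum>i=1..N. V (v i)) < (\<Sum>i=1..N. V (u i))"
  proof (rule sum_strict_mono_ex1)
    show "\<forall>i\<in>{1..N}. V (v i) \<le> V (u i)"
      using incr[OF t(1)] by (auto simp: v_def min_def less_imp_le)
    show "\<exists>i\<in>{1..N}. V (v i) < V (u i)"
      using incr[OF t(1,2)] k t by (intro bexI[of _ k]) (auto simp: v_def)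
  qed simp
  \<comment> \<open>Truncation is 1-Lipschitz, so no gradient term grows.\<close>
  moreover have "(bdry_ext bc N v (i + 1) - bdry_ext bc N v i)\<^sup>2
      \<le> (bdry_ext bc N u (i + 1) - bdry_ext bc N u i)\<^sup>2" for i
    unfolding v_def bdry_ext_min[OF t(3) \<open>N > 0\<close>] abs_le_square_iff[symmetric] by linarith
  then have "(\<Sum>i=0..N. 1 / 2 * \<delta>\<^sup>2 * (bdry_ext bc N v (i + 1) - bdry_ext bc N v i)\<^sup>2)
      \<le> (\<Sum>i=0..N. 1 / 2 * \<delta>\<^sup>2 * (bdry_ext bc N u (i + 1) - bdry_ext bc N u i)\<^sup>2)"
    by (intro sum_mono mult_left_mono) auto
  ultimately have "potential_energy V \<delta> bc N v < potential_energy V \<delta> bc N u"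
    unfolding potential_energy_def using \<open>N > 0\<close>
    by (intro add_less_le_mono mult_left_mono mult_strict_left_mono) auto
  with energy show False
    by simp
qed

lemma bdry_ext_uminus: "bdry_ext bc N (\<lambda>j. - u j) i = - bdry_ext bc N u i"
  by (auto simp: bdry_ext_def split: boundary.split)

text \<open>Turns the upper bound \<open>minimizer_le\<close> into a lower bound.\<close>

lemma minimizer_reflect:
  assumes "minimizer N (potential_energy V \<delta> bc N) u"
  shows "minimizer N (potential_energy (\<lambda>x. V (- x)) \<delta> bc N) (\<lambda>j. - u j)"
proof -
  have refl: "potential_energy (\<lambda>x. V (- x)) \<delta> bc N v = potential_energy V \<delta> bc N (\<lambda>j. - v j)" for v
    by (simp add: potential_energy_def bdry_ext_uminus power2_commute)
  from assms obtain e where "e > 0" and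
    emin: "\<And>v. (\<forall>j\<in>{1..N}. \<bar>v j - u j\<bar> < e) \<Longrightarrow>
      potential_energy V \<delta> bc N u \<le> potential_energy V \<delta> bc N v"
    unfolding minimizer_def by blast
  have "potential_energy V \<delta> bc N u \<le> potential_energy V \<delta> bc N (\<lambda>j. - v j)"
    if v: "\<forall>j\<in>{1..N}. \<bar>v j - (- u j)\<bar> < e" for v
  proof (rule emin, rule ballI)
    fix j assume "j \<in> {1..N}"
    with v have "\<bar>v j - (- u j)\<bar> < e" by blast
    then show "\<bar>- v j - u j\<bar> < e" by linarith
  qed
  with \<open>e > 0\<close> show ?thesis
    unfolding minimizer_def refl by auto
qed

text \<open>Outside [-B, B] with B = |a| + |b| there are no local minima of V, and V is coercive, so
  V increases strictly outwards on both sides. The bound depends on V alone.\<close>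

lemma minimizers_uniformly_bounded:
  fixes V :: "real \<Rightarrow> real"
  assumes cont: "continuous_on UNIV V"
    and "double_well V"
    and coercive: "\<exists>\<kappa>>0. \<exists>R. \<forall>x. \<bar>x\<bar> \<ge> R \<longrightarrow> V x \<ge> \<kappa> * x\<^sup>2"
  obtains B where "\<And>N \<delta> bc u j. N > 0 \<Longrightarrow> minimizer N (potential_energy V \<delta> bc N) u \<Longrightarrow>
    j \<in> {1..N} \<Longrightarrow> \<bar>u j\<bar> \<le> B"
proof -
  obtain a b where ab: "{x. \<forall>\<^sub>F y in nhds x. V x \<le> V y} = {a, b}"
    using assms(2) unfolding double_well_def by blast
  obtain \<kappa> R where \<kappa>: "\<kappa> > 0" "\<And>x. \<bar>x\<bar> \<ge> R \<Longrightarrow> V x \<ge> \<kappa> * x\<^sup>2"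
    using coercive by blast
  have large: "\<exists>z0. \<forall>z. \<bar>z\<bar> \<ge> z0 \<longrightarrow> V z > c" for c
  proof -
    \<comment> \<open>The summand 1 serves to replace |z| by its square, the last one to make
      \<kappa> * |z| exceed |c|.\<close>
    have "V z > c" if "\<bar>z\<bar> \<ge> \<bar>R\<bar> + 1 + \<bar>c\<bar> / \<kappa>" for z
    proof -
      have "0 \<le> \<bar>c\<bar> / \<kappa>" using \<kappa> by simp
      then have z: "\<bar>z\<bar> \<ge> R" "\<bar>z\<bar> \<ge> 1" "\<bar>z\<bar> > \<bar>c\<bar> / \<kappa>"
        using that by linarith+
      have "\<bar>c\<bar> < \<kappa> * \<bar>z\<bar>"
        using z \<kappa> by (simp add: field_simps)
      also have "\<dots> \<le> \<kappa> * \<bar>z\<bar>\<^sup>2"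
        using z \<kappa> by (intro mult_left_mono self_le_power) auto
      also have "\<dots> \<le> V z"
        using \<kappa> z by simp
      finally show ?thesis by linarith
    qed
    then show ?thesis by blast
  qed
  define B where "B = \<bar>a\<bar> + \<bar>b\<bar>"
  have B: "0 \<le> B" by (simp add: B_def)
  have no_min: "\<not> (\<forall>\<^sub>F y in nhds x. V x \<le> V y)" if "\<bar>x\<bar> > B" for x
  proof -
    have "x \<notin> {a, b}" using that by (auto simp: B_def)
    then show ?thesis using ab by blast
  qed
  have right: "V x < V y" if "B \<le> x" "x < y" for x y
  proof (rule strict_increasing_right_of_local_minima[OF cont _ _ that])
    show "\<not> (\<forall>\<^sub>F y in nhds x. V x \<le> V y)" if "x > B" for x
      using no_min that by simp
    show "\<exists>z>x. V z > V x" for x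
    proof -
      obtain z0 where "\<And>z. \<bar>z\<bar> \<ge> z0 \<Longrightarrow> V z > V x" using large by blast
      then show ?thesis by (intro exI[of _ "\<bar>x\<bar> + \<bar>z0\<bar> + 1"]) auto
    qed
  qed
  have left: "V (- x) < V (- y)" if "B \<le> x" "x < y" for x y
  proof (rule strict_increasing_right_of_local_minima[where V = "\<lambda>x. V (- x)", OF _ _ _ that])
    show "continuous_on UNIV (\<lambda>x. V (- x))"
      by (intro continuous_on_compose2[OF cont] continuous_intros) auto
    show "\<not> (\<forall>\<^sub>F y in nhds x. V (- x) \<le> V (- y))" if "x > B" for x
    proof
      assume "\<forall>\<^sub>F y in nhds x. V (- x) \<le> V (- y)"
      moreover have "filterlim uminus (nhds x) (nhds (- x))"
        using tendsto_minus[OF filterlim_ident, of "- x"] by (simp add: id_def)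
      ultimately have "\<forall>\<^sub>F y in nhds (- x). V (- x) \<le> V (- (- y))"
        by (rule eventually_compose_filterlim)
      then show False
        using no_min[of "- x"] that by simp
    qed
    show "\<exists>z>x. V (- z) > V (- x)" for x
    proof -
      obtain z0 where "\<And>z. \<bar>z\<bar> \<ge> z0 \<Longrightarrow> V z > V (- x)" using large by blast
      then show ?thesis by (intro exI[of _ "\<bar>x\<bar> + \<bar>z0\<bar> + 1"]) auto
    qed
  qed
  show ?thesis
  proof
    fix N :: nat and \<delta> bc u j
    assume *: "N > 0" "minimizer N (potential_energy V \<delta> bc N) u" "j \<in> {1..N}"
    have "u j \<le> B"
      using minimizer_le[OF *(2,1) B right *(3)] .
    moreover have "- u j \<le> B"
      using minimizer_le[OF minimizer_reflect[OF *(2)] *(1) B left *(3)] .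
    ultimately show "\<bar>u j\<bar> \<le> B" by linarith
  qed
qed

section \<open>The quadratic form of the discretized Hessian and its eigenvectors\<close>

lemma sum_by_parts_laplacian:
  fixes f g :: "nat \<Rightarrow> 'a::comm_ring_1"
  shows "(\<Sum>j=1..N. f j * (2 * g j - g (j - 1) - g (j + 1))) =
    (\<Sum>j=0..N. (f (j + 1) - f j) * (g (j + 1) - g j))
      - f (N + 1) * (g (N + 1) - g N) + f 0 * (g 1 - g 0)"
  by (induction N) (simp_all add: algebra_simps)

text \<open>For \<open>W\<close> = V'' this is N times the second derivative of
  \<open>potential_energy\<close> at \<open>u\<close>. Writing it with first differences makes its
  symmetry and the sign of the gradient part visible.\<close>

definition hessian_form ::
  "(real \<Rightarrow> real) \<Rightarrow> real \<Rightarrow> boundary \<Rightarrow> nat \<Rightarrow> (nat \<Rightarrow> real) \<Rightarrow> (nat \<Rightarrow> real) \<Rightarrow> (nat \<Rightarrow> real) \<Rightarrow> real"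
where
  "hessian_form W \<delta> bc N u v w =
     \<delta>\<^sup>2 * (real N)\<^sup>2 * (\<Sum>j=0..N. (bdry_ext bc N v (j + 1) - bdry_ext bc N v j) *
       (bdry_ext bc N w (j + 1) - bdry_ext bc N w j)) + (\<Sum>j=1..N. W (u j) * v j * w j)"

lemma bdry_ext_inside [simp]: "j \<in> {1..N} \<Longrightarrow> bdry_ext bc N w j = w j"
  by (simp add: bdry_ext_def)

lemma bdry_ext_lincomb:
  "bdry_ext bc N (\<lambda>j. \<Sum>i\<in>I. c i * f i j) j = (\<Sum>i\<in>I. c i * bdry_ext bc N (f i) j)"
  by (auto simp: bdry_ext_def split: boundary.split)

lemma hessian_form_commute: "hessian_form W \<delta> bc N u v w = hessian_form W \<delta> bc N u w v"
  by (simp add: hessian_form_def mult_ac)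

lemma hessian_form_lincomb:
  "hessian_form W \<delta> bc N u v (\<lambda>j. \<Sum>i\<in>I. c i * f i j) = (\<Sum>i\<in>I. c i * hessian_form W \<delta> bc N u v (f i))"
proof -
  have "(\<Sum>j=0..N. (bdry_ext bc N v (j + 1) - bdry_ext bc N v j) *
      ((\<Sum>i\<in>I. c i * bdry_ext bc N (f i) (j + 1)) - (\<Sum>i\<in>I. c i * bdry_ext bc N (f i) j)))
    = (\<Sum>i\<in>I. c i * (\<Sum>j=0..N. (bdry_ext bc N v (j + 1) - bdry_ext bc N v j) *
        (bdry_ext bc N (f i) (j + 1) - bdry_ext bc N (f i) j)))"
    unfolding sum_subtractf[symmetric] sum_distrib_left
    by (subst sum.swap) (intro sum.cong refl, simp add: algebra_simps)
  moreover have "(\<Sum>j=1..N. W (u j) * v j * (\<Sum>i\<in>I. c i * f i j))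
    = (\<Sum>i\<in>I. c i * (\<Sum>j=1..N. W (u j) * v j * f i j))"
    unfolding sum_distrib_left
    by (subst sum.swap) (intro sum.cong refl, simp add: algebra_simps)
  ultimately show ?thesis
    unfolding hessian_form_def bdry_ext_lincomb
    by (simp add: distrib_left sum.distrib sum_distrib_left mult_ac)
qed

text \<open>The weak form of the eigenvalue equation, obtained by summation by parts.\<close>

lemma hessian_form_eigenpair:
  assumes "hessian_eigenpair W \<delta> bc N u \<mu> \<psi>"
  shows "hessian_form W \<delta> bc N u v \<psi> = \<mu> * (\<Sum>j=1..N. v j * \<psi> j)"
proof (cases "N = 0")
  case True
  then show ?thesis
    by (simp add: hessian_form_def)
next
  case False
  let ?v = "bdry_ext bc N v" and ?\<psi> = "bdry_ext bc N \<psi>"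
  \<comment> \<open>Under Dirichlet conditions the values of \<open>?v\<close> vanish; under Neumann
    conditions the increments of the extended eigenvector do.\<close>
  have boundary: "?v (N + 1) * (?\<psi> (N + 1) - ?\<psi> N) = 0" "?v 0 * (?\<psi> 1 - ?\<psi> 0) = 0"
    using False by (auto simp: bdry_ext_def Suc_le_eq split: boundary.split)
  have "\<mu> * (\<Sum>j=1..N. v j * \<psi> j) = (\<Sum>j=1..N. v j * (\<mu> * \<psi> j))"
    by (simp add: sum_distrib_left mult_ac)
  also have "\<dots> = (\<Sum>j=1..N. \<delta>\<^sup>2 * (real N)\<^sup>2 *
      (?v j * (2 * ?\<psi> j - ?\<psi> (j - 1) - ?\<psi> (j + 1))) + W (u j) * v j * \<psi> j)"
  proof (rule sum.cong[OF refl])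
    fix j assume j: "j \<in> {1..N}"
    then have "\<mu> * \<psi> j = - \<delta>\<^sup>2 * (real N)\<^sup>2 * (?\<psi> (j - 1) - 2 * ?\<psi> j + ?\<psi> (j + 1)) + W (u j) * \<psi> j"
      using assms unfolding hessian_eigenpair_def by blast
    moreover have "?v j = v j"
      using j by simp
    ultimately show "v j * (\<mu> * \<psi> j) = \<delta>\<^sup>2 * (real N)\<^sup>2 *
        (?v j * (2 * ?\<psi> j - ?\<psi> (j - 1) - ?\<psi> (j + 1))) + W (u j) * v j * \<psi> j"
      by (simp only:) (simp only: algebra_simps)
  qed
  also have "\<dots> = hessian_form W \<delta> bc N u v \<psi>"
    unfolding sum.distrib sum_distrib_left[symmetric] sum_by_parts_laplacian boundary
    by (simp add: hessian_form_def)
  finally show ?thesis ..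
qed

lemma hessian_eigenvectors_orthogonal:
  assumes "hessian_eigenpair W \<delta> bc N u \<mu> \<phi>" "hessian_eigenpair W \<delta> bc N u \<nu> \<psi>" "\<mu> \<noteq> \<nu>"
  shows "(\<Sum>j=1..N. \<phi> j * \<psi> j) = 0"
proof -
  have "\<nu> * (\<Sum>j=1..N. \<phi> j * \<psi> j) = \<mu> * (\<Sum>j=1..N. \<psi> j * \<phi> j)"
    using hessian_form_eigenpair[OF assms(1), of \<psi>] hessian_form_eigenpair[OF assms(2), of \<phi>]
      hessian_form_commute[of W \<delta> bc N u \<phi> \<psi>] by simp
  then show ?thesis
    using assms(3) by (simp add: mult.commute)
qed

text \<open>Distinct eigenvalues make the eigenvectors orthogonal, and the normalization gives them
  squared Euclidean norm N, so both forms are diagonal in the coefficients.\<close>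

lemma hessian_form_eigenspan:
  assumes "finite I" "inj_on \<mu> I"
    and eigen: "\<And>i. i \<in> I \<Longrightarrow> hessian_eigenpair W \<delta> bc N u (\<mu> i) (\<psi> i)"
    and "N > 0"
  defines "w \<equiv> \<lambda>c j. \<Sum>i\<in>I. c i * \<psi> i j"
  shows "(\<Sum>j=1..N. (w c j)\<^sup>2) = real N * (\<Sum>i\<in>I. (c i)\<^sup>2)"
    and "hessian_form W \<delta> bc N u (w c) (w c) = real N * (\<Sum>i\<in>I. \<mu> i * (c i)\<^sup>2)"
proof -
  have inner: "(\<Sum>j=1..N. w c j * \<psi> i j) = real N * c i" if i: "i \<in> I" for i
  proof -
    have "(\<Sum>j=1..N. w c j * \<psi> i j) = (\<Sum>l\<in>I. c l * (\<Sum>j=1..N. \<psi> l j * \<psi> i j))"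
      unfolding w_def sum_distrib_left sum_distrib_right
      by (subst sum.swap) (simp add: mult_ac)
    also have "\<dots> = (\<Sum>l\<in>I. if l = i then real N * c i else 0)"
    proof (rule sum.cong[OF refl])
      fix l assume l: "l \<in> I"
      show "c l * (\<Sum>j=1..N. \<psi> l j * \<psi> i j) = (if l = i then real N * c i else 0)"
      proof (cases "l = i")
        case True
        have "(\<Sum>j=1..N. \<psi> i j * \<psi> i j) = real N"
          using eigen[OF i] \<open>N > 0\<close> by (simp add: hessian_eigenpair_def power2_eq_square)
        with True show ?thesis by simp
      next
        case False
        then have "\<mu> l \<noteq> \<mu> i"
          using \<open>inj_on \<mu> I\<close> l i by (auto dest: inj_onD)
        with False show ?thesis
          using hessian_eigenvectors_orthogonal[OF eigen[OF l] eigen[OF i]] by simp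
      qed
    qed
    finally show ?thesis
      using i \<open>finite I\<close> by simp
  qed
  have "(\<Sum>j=1..N. (w c j)\<^sup>2) = (\<Sum>j=1..N. w c j * (\<Sum>i\<in>I. c i * \<psi> i j))"
    by (simp add: w_def power2_eq_square)
  also have "\<dots> = (\<Sum>i\<in>I. c i * (\<Sum>j=1..N. w c j * \<psi> i j))"
    unfolding sum_distrib_left by (subst sum.swap) (simp add: mult_ac)
  also have "\<dots> = (\<Sum>i\<in>I. c i * (real N * c i))"
    using inner by (intro sum.cong) auto
  also have "\<dots> = real N * (\<Sum>i\<in>I. (c i)\<^sup>2)"
    by (simp add: sum_distrib_left power2_eq_square mult_ac)
  finally show "(\<Sum>j=1..N. (w c j)\<^sup>2) = real N * (\<Sum>i\<in>I. (c i)\<^sup>2)" .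
  have "hessian_form W \<delta> bc N u (w c) (w c) = (\<Sum>i\<in>I. c i * hessian_form W \<delta> bc N u (w c) (\<psi> i))"
    by (subst (2) w_def) (rule hessian_form_lincomb)
  also have "\<dots> = (\<Sum>i\<in>I. c i * (\<mu> i * (real N * c i)))"
    using hessian_form_eigenpair[OF eigen] inner by (intro sum.cong) auto
  also have "\<dots> = real N * (\<Sum>i\<in>I. \<mu> i * (c i)\<^sup>2)"
    by (simp add: sum_distrib_left power2_eq_square mult_ac)
  finally show "hessian_form W \<delta> bc N u (w c) (w c) = real N * (\<Sum>i\<in>I. \<mu> i * (c i)\<^sup>2)" .
qed

section \<open>Discrete Poincare inequality and eigenvalue lower bounds\<close>

lemma increment_squared_le:
  fixes f :: "nat \<Rightarrow> real"
  assumes "p \<le> q"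
  shows "(f q - f p)\<^sup>2 \<le> real (q - p) * (\<Sum>i=p..<q. (f (i + 1) - f i)\<^sup>2)"
proof -
  have "(f q - f p)\<^sup>2 = (\<Sum>i=p..<q. f (i + 1) - f i)\<^sup>2"
    using sum_Suc_diff'[OF assms, of f] by simp
  also have "\<dots> \<le> (\<Sum>i=p..<q. 1\<^sup>2) * (\<Sum>i=p..<q. (f (i + 1) - f i)\<^sup>2)"
    using Cauchy_Schwarz_ineq_sum[of "\<lambda>_. 1" "\<lambda>i. f (i + 1) - f i" "{p..<q}"] by simp
  finally show ?thesis by simp
qed

text \<open>Every grid point lies within distance L of a zero of \<open>f\<close>, so Cauchy-Schwarz
  along the connecting path bounds its value. Each increment is charged by at most 2 L points, which
  yields the second factor L.\<close>

lemma discrete_poincare: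
  fixes f :: "nat \<Rightarrow> real"
  assumes L: "0 < L" "L \<le> N" and zero: "\<And>p. p \<in> {1..N} \<Longrightarrow> L dvd p \<Longrightarrow> f p = 0"
  shows "(\<Sum>j=1..N. (f j)\<^sup>2) \<le> 2 * (real L)\<^sup>2 * (\<Sum>i=0..N. (f (i + 1) - f i)\<^sup>2)"
proof -
  define D where "D i = (f (i + 1) - f i)\<^sup>2" for i
  have D: "D i \<ge> 0" for i by (simp add: D_def)
  have pointwise: "(f j)\<^sup>2 \<le> real L * (\<Sum>i | i \<in> {0..N} \<and> i < j + L \<and> j \<le> i + L. D i)"
    if j: "j \<in> {1..N}" for j
  proof -
    \<comment> \<open>The path joins j to the largest multiple of L below or at j. For j < L that
      would be 0, where \<open>f\<close> need not vanish, so L itself is taken; it is a grid point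
      because L <= N.\<close>
    define p q where "p = min j (if j < L then L else L * (j div L))"
      and "q = max j (if j < L then L else L * (j div L))"
    have mult: "L * (j div L) \<le> j" "j < L * (j div L) + L"
      using dividend_less_times_div[OF L(1), of j] by simp_all
    have multN: "L * (j div L) \<le> N"
      using mult(1) j by (meson atLeastAtMost_iff le_trans)
    have pq: "p \<le> q" "q - p \<le> L" "{p..<q} \<subseteq> {i. i \<in> {0..N} \<and> i < j + L \<and> j \<le> i + L}"
      using j mult L by (auto simp: p_def q_def min_def max_def split: if_splits)
    have "f (if j < L then L else L * (j div L)) = 0"
    proof (rule zero)
      show "(if j < L then L else L * (j div L)) \<in> {1..N}"
        using j L multN div_greater_zero_iff[of j L] by (auto simp: Suc_le_eq)
    qed auto
    then have "(f j)\<^sup>2 = (f q - f p)\<^sup>2"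
      by (auto simp: p_def q_def min_def max_def)
    also have "\<dots> \<le> real (q - p) * (\<Sum>i=p..<q. D i)"
      unfolding D_def by (rule increment_squared_le[OF pq(1)])
    also have "\<dots> \<le> real L * (\<Sum>i | i \<in> {0..N} \<and> i < j + L \<and> j \<le> i + L. D i)"
      using pq by (intro mult_mono sum_mono2 sum_nonneg) (auto simp: D)
    finally show ?thesis .
  qed
  have count: "card {j \<in> {1..N}. i < j + L \<and> j \<le> i + L} \<le> 2 * L" for i
  proof -
    have "card {j \<in> {1..N}. i < j + L \<and> j \<le> i + L} \<le> card {i + 1 - L..<i + 1 + L}"
      by (intro card_mono) auto
    also have "\<dots> \<le> 2 * L" by simp
    finally show ?thesis .
  qed
  have "(\<Sum>j=1..N. (f j)\<^sup>2)
      \<le> (\<Sum>j=1..N. real L * (\<Sum>i | i \<in> {0..N} \<and> i < j + L \<and> j \<le> i + L. D i))"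
    by (intro sum_mono pointwise)
  also have "\<dots> = real L * (\<Sum>i=0..N. \<Sum>j | j \<in> {1..N} \<and> i < j + L \<and> j \<le> i + L. D i)"
    unfolding sum_distrib_left[symmetric] by (subst sum.swap_restrict) auto
  also have "\<dots> \<le> real L * (\<Sum>i=0..N. real (2 * L) * D i)"
    using count D by (intro mult_left_mono sum_mono) (auto intro!: mult_right_mono simp del: of_nat_mult)
  also have "\<dots> = 2 * (real L)\<^sup>2 * (\<Sum>i=0..N. D i)"
    by (simp add: sum_distrib_left power2_eq_square mult_ac)
  finally show ?thesis
    by (simp add: D_def)
qed

text \<open>The Poincare inequality handles the gradient part; the potential part costs at most
  \<open>K\<close>.\<close>

lemma hessian_form_lower_bound:
  assumes L: "0 < L" "L \<le> N" and zero: "\<And>p. p \<in> {1..N} \<Longrightarrow> L dvd p \<Longrightarrow> w p = 0"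
    and W: "\<And>j. j \<in> {1..N} \<Longrightarrow> W (u j) \<ge> - K"
  shows "(\<delta>\<^sup>2 * (real N)\<^sup>2 / (2 * (real L)\<^sup>2) - K) * (\<Sum>j=1..N. (w j)\<^sup>2)
    \<le> hessian_form W \<delta> bc N u w w"
proof -
  let ?S = "\<Sum>j=1..N. (w j)\<^sup>2"
  let ?D = "\<Sum>i=0..N. (bdry_ext bc N w (i + 1) - bdry_ext bc N w i)\<^sup>2"
  have "?S \<le> 2 * (real L)\<^sup>2 * ?D"
    using discrete_poincare[OF L, of "bdry_ext bc N w"] zero by simp
  then have "?S / (2 * (real L)\<^sup>2) \<le> ?D"
    using L by (simp add: field_simps)
  then have "\<delta>\<^sup>2 * (real N)\<^sup>2 * (?S / (2 * (real L)\<^sup>2)) \<le> \<delta>\<^sup>2 * (real N)\<^sup>2 * ?D"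
    by (intro mult_left_mono) auto
  moreover have "- K * ?S \<le> (\<Sum>j=1..N. W (u j) * w j * w j)"
    unfolding sum_distrib_left
  proof (rule sum_mono)
    fix j assume "j \<in> {1..N}"
    then have "- K * (w j)\<^sup>2 \<le> W (u j) * (w j)\<^sup>2"
      by (intro mult_right_mono W) auto
    then show "- K * (w j)\<^sup>2 \<le> W (u j) * w j * w j"
      by (simp add: power2_eq_square mult.assoc)
  qed
  ultimately show ?thesis
    unfolding hessian_form_def by (simp add: power2_eq_square left_diff_distrib)
qed

text \<open>Courant--Fischer: the span of the first \<open>k\<close> eigenvectors contains a nonzero vector vanishing
  at the fewer than \<open>k\<close> multiples of the spacing \<open>N div (k - 1) + 1\<close>.\<close>

lemma hessian_eigenvalue_lower_bound:
  assumes k: "3 \<le> k" "k \<le> N"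
    and eigen: "\<And>i. i \<in> {1..k} \<Longrightarrow> hessian_eigenpair W \<delta> bc N u (\<mu> i) (\<psi> i)"
    and mono: "\<And>i j. 1 \<le> i \<Longrightarrow> i < j \<Longrightarrow> j \<le> k \<Longrightarrow> \<mu> i < \<mu> j"
    and W: "\<And>j. j \<in> {1..N} \<Longrightarrow> W (u j) \<ge> - K"
  shows "\<delta>\<^sup>2 / 32 * (real k)\<^sup>2 - K \<le> \<mu> k"
proof -
  define L where "L = N div (k - 1) + 1"
  define P where "P = {p \<in> {1..N}. L dvd p}"
  have "(k - 1) * (N div (k - 1)) \<le> N"
    by simp
  moreover have "2 * (N div (k - 1)) \<le> (k - 1) * (N div (k - 1))"
    using k by (intro mult_right_mono) auto
  moreover have "(k - 1) * L = (k - 1) * (N div (k - 1)) + (k - 1)"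
    by (simp add: L_def distrib_left)
  \<comment> \<open>Since k - 1 >= 2, the spacing is at most N / 2 + 1, hence at most N.\<close>
  ultimately have L: "0 < L" "L \<le> N" "(k - 1) * L \<le> 2 * N"
    using k unfolding L_def by linarith+
  have "N < (k - 1) * L"
    using dividend_less_times_div[of "k - 1" N] k by (simp add: L_def distrib_left)
  then have "N div L < k - 1"
    using L by (simp add: div_less_iff_less_mult)
  moreover have "P \<subseteq> (\<lambda>q. L * q) ` {1..N div L}"
  proof
    fix p assume "p \<in> P"
    then obtain q where "p = L * q" "p \<in> {1..N}"
      by (auto simp: P_def)
    then show "p \<in> (\<lambda>q. L * q) ` {1..N div L}"
      using L by (auto simp: less_eq_div_iff_mult_less_eq mult.commute)
  qed
  then have "card P \<le> N div L"
    using surj_card_le[of "{1..N div L}" P "\<lambda>q. L * q"] by simp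
  ultimately have "card P < card {1..k}"
    by simp
  moreover have "finite P"
    by (simp add: P_def)
  ultimately obtain c where c: "\<exists>i\<in>{1..k}. c i \<noteq> 0" "\<forall>p\<in>P. (\<Sum>i=1..k. c i * \<psi> i p) = 0"
    using homogeneous_system_nontrivial_solution[of P "{1..k}" \<psi>] by blast
  define w where "w = (\<lambda>j. \<Sum>i=1..k. c i * \<psi> i j)"
  have inj: "inj_on \<mu> {1..k}"
    using mono by (intro linorder_inj_onI) fastforce+
  have N: "N > 0" using k by simp
  have span: "(\<Sum>j=1..N. (w j)\<^sup>2) = real N * (\<Sum>i=1..k. (c i)\<^sup>2)"
    "hessian_form W \<delta> bc N u w w = real N * (\<Sum>i=1..k. \<mu> i * (c i)\<^sup>2)"
    unfolding w_def by (rule hessian_form_eigenspan[OF finite_atLeastAtMost inj eigen N], assumption)+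
  have pos: "0 < (\<Sum>i=1..k. (c i)\<^sup>2)"
    using c(1) by (auto intro!: sum_pos2)
  \<comment> \<open>The form at \<open>w\<close> is squeezed between the Poincare bound, as
    \<open>w\<close> vanishes on \<open>P\<close>, and the top eigenvalue of the span.\<close>
  have "(\<delta>\<^sup>2 * (real N)\<^sup>2 / (2 * (real L)\<^sup>2) - K) * (\<Sum>j=1..N. (w j)\<^sup>2) \<le> hessian_form W \<delta> bc N u w w"
    using c(2) by (intro hessian_form_lower_bound L W) (auto simp: w_def P_def)
  also have "\<dots> = real N * (\<Sum>i=1..k. \<mu> i * (c i)\<^sup>2)"
    by (rule span(2))
  also have "\<dots> \<le> real N * (\<Sum>i=1..k. \<mu> k * (c i)\<^sup>2)"
    using mono[of _ k] by (intro mult_left_mono sum_mono mult_right_mono) (auto simp: le_less)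
  also have "\<dots> = \<mu> k * (\<Sum>j=1..N. (w j)\<^sup>2)"
    unfolding span(1) by (simp add: sum_distrib_left mult_ac)
  finally have bound: "\<delta>\<^sup>2 * (real N)\<^sup>2 / (2 * (real L)\<^sup>2) - K \<le> \<mu> k"
    by (rule mult_right_le_imp_le) (unfold span(1), use pos N in simp)
  \<comment> \<open>From k / 2 <= k - 1 follows k L <= 4 N; squared and divided by 2 this gives the
    constant 32.\<close>
  have "real k / 2 * real L \<le> real (k - 1) * real L"
    using k by (intro mult_right_mono) auto
  also have "\<dots> \<le> 2 * real N"
    using L(3) by (metis of_nat_le_iff of_nat_mult of_nat_numeral)
  finally have "(real k * real L)\<^sup>2 \<le> (4 * real N)\<^sup>2"
    by (intro power_mono) auto
  then have "(real k)\<^sup>2 / 32 \<le> (real N)\<^sup>2 / (2 * (real L)\<^sup>2)"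
    using L by (simp add: field_simps power_mult_distrib)
  then have "\<delta>\<^sup>2 * ((real k)\<^sup>2 / 32) \<le> \<delta>\<^sup>2 * ((real N)\<^sup>2 / (2 * (real L)\<^sup>2))"
    by (intro mult_left_mono) auto
  with bound show ?thesis
    by simp
qed

section \<open>Gaussian mass of intervals and boxes\<close>

lemma gaussian_integral:
  fixes a :: real
  assumes "a > 0"
  shows "integrable lborel (\<lambda>x. exp (- a * x\<^sup>2))" (is ?int)
    and "(LINT x|lborel. exp (- a * x\<^sup>2)) = sqrt (pi / a)" (is ?val)
proof -
  have eq: "exp (- a * x\<^sup>2) = sqrt (pi / a) * normal_density 0 (1 / sqrt (2 * a)) x" for x
    using assms by (simp add: normal_density_def power_divide real_sqrt_divide field_simps)
  show ?int ?val
    unfolding eq using assms by simp_all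
qed

text \<open>Outside the interval half of the exponent is at least a d^2 / 2, and the other half
  remains as a Gaussian of rate a / 2, whose total mass is larger by the factor sqrt 2.\<close>

lemma gaussian_interval_ratio:
  fixes a d :: real
  assumes "a > 0" "d > 0"
  defines "r \<equiv> (LINT x:{- d..d}|lborel. exp (- a * x\<^sup>2)) / (LINT x|lborel. exp (- a * x\<^sup>2))"
  shows "r \<le> 1" and "1 - sqrt 2 * exp (- a * d\<^sup>2 / 2) \<le> r"
proof -
  let ?g = "\<lambda>x::real. exp (- a * x\<^sup>2)"
  note int = gaussian_integral(1)[OF \<open>a > 0\<close>]
  have pos: "0 < integral\<^sup>L lborel ?g"
    unfolding gaussian_integral(2)[OF \<open>a > 0\<close>] using assms by simp
  have int_box: "integrable lborel (\<lambda>x. indicator {- d..d} x *\<^sub>R ?g x)"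
    using int by (intro integrable_mult_indicator) auto
  have "(LINT x:{- d..d}|lborel. ?g x) \<le> integral\<^sup>L lborel ?g"
    unfolding set_lebesgue_integral_def using int int_box
    by (intro integral_mono) (auto simp: indicator_def)
  then show "r \<le> 1"
    unfolding r_def using pos by simp
  have "integral\<^sup>L lborel ?g - (LINT x:{- d..d}|lborel. ?g x)
      = (LINT x|lborel. ?g x - indicator {- d..d} x *\<^sub>R ?g x)"
    unfolding set_lebesgue_integral_def using int int_box by simp
  also have "\<dots> \<le> (LINT x|lborel. exp (- a * d\<^sup>2 / 2) * exp (- (a / 2) * x\<^sup>2))"
  proof (intro integral_mono Bochner_Integration.integrable_diff integrable_mult_right int int_box
      gaussian_integral(1))
    fix x :: real
    have "?g x \<le> exp (- a * d\<^sup>2 / 2) * exp (- (a / 2) * x\<^sup>2)" if "x \<notin> {- d..d}"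
    proof -
      have "d\<^sup>2 \<le> x\<^sup>2"
        using that \<open>d > 0\<close> by (auto simp: abs_le_square_iff[symmetric])
      then have "a * d\<^sup>2 \<le> a * x\<^sup>2"
        using \<open>a > 0\<close> by simp
      then show ?thesis
        unfolding exp_add[symmetric] by simp
    qed
    then show "?g x - indicator {- d..d} x *\<^sub>R ?g x \<le> exp (- a * d\<^sup>2 / 2) * exp (- (a / 2) * x\<^sup>2)"
      by (auto simp: indicator_def)
  qed (use assms in auto)
  also have "\<dots> = sqrt 2 * exp (- a * d\<^sup>2 / 2) * integral\<^sup>L lborel ?g"
    using gaussian_integral(2)[of a] gaussian_integral(2)[of "a / 2"] assms
    by (simp add: real_sqrt_divide real_sqrt_mult)
  finally show "1 - sqrt 2 * exp (- a * d\<^sup>2 / 2) \<le> r"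
    unfolding r_def using pos by (simp add: field_simps)
qed

lemma gaussian_box_ratio:
  fixes a d :: "nat \<Rightarrow> real"
  assumes a: "\<And>j. j \<in> {1..N} \<Longrightarrow> a j > 0" and d: "\<And>j. d j > 0"
  shows "1 - (\<Sum>j=1..N. sqrt 2 * exp (- a j * (d j)\<^sup>2 / 2)) \<le>
    (LINT b:coord_box d N|lebesgue_N N. exp (- (\<Sum>j=1..N. a j * (b j)\<^sup>2))) /
    (LINT b|lebesgue_N N. exp (- (\<Sum>j=1..N. a j * (b j)\<^sup>2)))"
proof -
  interpret product_sigma_finite "\<lambda>_ :: nat. lborel :: real measure" ..
  let ?g = "\<lambda>j x. exp (- a j * x\<^sup>2)"
  have prod: "exp (- (\<Sum>j=1..N. a j * (b j)\<^sup>2)) = (\<Prod>j=1..N. ?g j (b j))" for b :: "nat \<Rightarrow> real"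
    by (simp add: exp_sum[symmetric] sum_negf)
  have whole: "(LINT b|lebesgue_N N. exp (- (\<Sum>j=1..N. a j * (b j)\<^sup>2)))
      = (\<Prod>j=1..N. integral\<^sup>L lborel (?g j))"
    unfolding prod using gaussian_integral(1)[OF a] by (intro product_integral_prod) auto
  have "(LINT b:coord_box d N|lebesgue_N N. exp (- (\<Sum>j=1..N. a j * (b j)\<^sup>2)))
      = (LINT b|lebesgue_N N. (\<Prod>j=1..N. indicator {- d j..d j} (b j) *\<^sub>R ?g j (b j)))"
    unfolding set_lebesgue_integral_def
  proof (rule Bochner_Integration.integral_cong[OF refl])
    fix b assume "b \<in> space (lebesgue_N N)"
    \<comment> \<open>Membership in \<open>coord_box\<close> includes extensionality, which the
      product of indicators does not test.\<close>
    then have "b \<in> extensional {1..N}"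
      by (simp add: space_PiM PiE_def)
    then have "(indicator (coord_box d N) b :: real) = (\<Prod>j=1..N. indicator {- d j..d j} (b j))"
      by (auto simp: coord_box_def indicator_def PiE_def Pi_def prod.neutral intro!: prod_zero[symmetric])
    then show "indicator (coord_box d N) b *\<^sub>R exp (- (\<Sum>j=1..N. a j * (b j)\<^sup>2))
        = (\<Prod>j=1..N. indicator {- d j..d j} (b j) *\<^sub>R ?g j (b j))"
      unfolding prod by (simp add: prod.distrib)
  qed
  also have "\<dots> = (\<Prod>j=1..N. LINT x:{- d j..d j}|lborel. ?g j x)"
    unfolding set_lebesgue_integral_def
    using gaussian_integral(1)[OF a]
    by (intro product_integral_prod integrable_mult_indicator) auto
  finally have box: "(LINT b:coord_box d N|lebesgue_N N. exp (- (\<Sum>j=1..N. a j * (b j)\<^sup>2)))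
      = (\<Prod>j=1..N. LINT x:{- d j..d j}|lborel. ?g j x)" .
  define r where "r j = (LINT x:{- d j..d j}|lborel. ?g j x) / integral\<^sup>L lborel (?g j)" for j
  have r: "1 - sqrt 2 * exp (- a j * (d j)\<^sup>2 / 2) \<le> r j" "r j \<le> 1" "0 \<le> r j" if "j \<in> {1..N}" for j
    unfolding r_def set_lebesgue_integral_def
    using gaussian_interval_ratio[OF a[OF that] d[of j]]
    by (auto simp: set_lebesgue_integral_def intro!: divide_nonneg_nonneg)
  have "1 - (\<Sum>j=1..N. sqrt 2 * exp (- a j * (d j)\<^sup>2 / 2)) \<le> 1 - (\<Sum>j=1..N. 1 - r j)"
    using r(1) by (intro diff_left_mono sum_mono) (simp add: algebra_simps)
  also have "\<dots> \<le> (\<Prod>j=1..N. 1 - (1 - r j))"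
    using r by (intro Weierstrass_prod_ineq) auto
  finally show ?thesis
    unfolding whole box by (simp add: r_def prod_dividef)
qed

text \<open>The fourth power suits exponents growing like sqrt j: the resulting bound decays like 1
  / j^2 and is summable.\<close>

lemma exp_minus_le_inverse_power4:
  fixes x :: real
  assumes "x > 0"
  shows "exp (- x) \<le> 256 / x ^ 4"
proof -
  have "x / 4 \<le> exp (x / 4)"
    using exp_ge_add_one_self[of "x / 4"] by linarith
  then have "(x / 4) ^ 4 \<le> exp (x / 4) ^ 4"
    using assms by (intro power_mono) auto
  also have "\<dots> = exp x"
    by (simp add: exp_of_nat_mult[symmetric])
  finally show ?thesis
    using assms by (simp add: exp_minus field_simps)
qed

text \<open>The half-widths \<open>(j + 1) powr (- 3/4)\<close> are square summable, yet \<open>j\<^sup>2 * (d j)\<^sup>2\<close> still grows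
  like \<open>sqrt j\<close>, so that the Gaussian tails are summable.\<close>

lemma gaussian_box_ratio_tendsto_1_uniformly:
  fixes lam :: "nat \<Rightarrow> nat \<Rightarrow> real"
  assumes c: "c > 0" "\<And>N k. k \<in> {1..N} \<Longrightarrow> c * (real k)\<^sup>2 \<le> lam N k"
    and "\<epsilon> > 0"
  shows "\<exists>\<beta>1>0. \<exists>d :: nat \<Rightarrow> real. (\<forall>j. d j > 0) \<and> summable (\<lambda>j. (d j)\<^sup>2) \<and>
    (\<forall>\<beta>>\<beta>1. \<forall>N>0.
      (LINT b:coord_box d N|lebesgue_N N. exp (- (\<beta> / 2) * (\<Sum>j=1..N. lam N j * (b j)\<^sup>2))) /
      (LINT b|lebesgue_N N. exp (- (\<beta> / 2) * (\<Sum>j=1..N. lam N j * (b j)\<^sup>2)))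
      > 1 - \<epsilon>)"
proof -
  define d :: "nat \<Rightarrow> real" where "d j = real (j + 1) powr (- 3 / 4)" for j
  have d: "d j > 0" for j
    by (simp add: d_def)
  have d2: "(d j)\<^sup>2 = real (j + 1) powr (- 3 / 2)" for j
    by (simp add: d_def power2_eq_square powr_add[symmetric])
  have d8: "(d j) ^ 8 = 1 / real (j + 1) ^ 6" for j
  proof -
    have "(d j) ^ 8 = real (j + 1) powr (- 6)"
      by (simp add: d_def powr_power)
    also have "\<dots> = 1 / real (j + 1) ^ 6"
      by (simp add: powr_minus_divide)
    finally show ?thesis .
  qed
  have "summable (\<lambda>j. real j powr (- 3 / 2))"
    by (simp add: summable_real_powr_iff)
  then have "summable (\<lambda>j. (d j)\<^sup>2)"
    unfolding d2 using summable_Suc_iff[of "\<lambda>j. real j powr (- 3 / 2)"] by simp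
  have "summable (\<lambda>j. 1 / real j ^ 2)"
    using inverse_power_summable[of 2, where 'a = real] by (simp add: divide_inverse)
  then have summ: "summable (\<lambda>j. 1 / real (j + 1) ^ 2)"
    using summable_Suc_iff[of "\<lambda>j. 1 / real j ^ 2"] by simp
  define S where "S = (\<Sum>j. 1 / real (j + 1) ^ 2)"
  \<comment> \<open>The factor 2 absorbs sqrt 2, 256 comes from the bound on exp, and 16 / c from
    the constant in \<open>x\<close> below.\<close>
  define M where "M = 2 * 256 * (16 / c) ^ 4"
  \<comment> \<open>The first entry allows \<beta> ^ 4 to be replaced by \<beta>; the second makes M
    * S / \<beta> less than \<epsilon>.\<close>
  define \<beta>1 where "\<beta>1 = max 1 (M * S / \<epsilon>)"
  have M: "M > 0" using c by (simp add: M_def)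
  have tail: "sqrt 2 * exp (- (\<beta> / 2 * lam N j) * (d j)\<^sup>2 / 2) \<le> M / \<beta> * (1 / real (j + 1) ^ 2)"
    if \<beta>: "\<beta> \<ge> 1" and j: "j \<in> {1..N}" for \<beta> N j
  proof -
    \<comment> \<open>A lower bound for the exponent: j >= (j + 1) / 2 turns the factor 1/4 into
      1/16.\<close>
    define x where "x = \<beta> * c / 16 * (real (j + 1))\<^sup>2 * (d j)\<^sup>2"
    have x: "x > 0"
      using \<beta> c d[of j] by (simp add: x_def)
    have "(real (j + 1) / 2)\<^sup>2 \<le> (real j)\<^sup>2"
      using j by (intro power_mono) auto
    then have "c * (real (j + 1) / 2)\<^sup>2 \<le> lam N j"
      using c(1) c(2)[OF j] by (meson mult_left_mono less_imp_le order_trans)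
    then have "\<beta> / 4 * (d j)\<^sup>2 * (c * (real (j + 1) / 2)\<^sup>2) \<le> \<beta> / 4 * (d j)\<^sup>2 * lam N j"
      using \<beta> by (intro mult_left_mono) auto
    then have "x \<le> \<beta> / 2 * lam N j * (d j)\<^sup>2 / 2"
      by (simp add: x_def power_divide mult_ac)
    then have "exp (- (\<beta> / 2 * lam N j) * (d j)\<^sup>2 / 2) \<le> exp (- x)"
      by simp
    also have "\<dots> \<le> 256 / x ^ 4"
      using x by (rule exp_minus_le_inverse_power4)
    also have "x ^ 4 = (\<beta> * c / 16) ^ 4 * real (j + 1) ^ 8 * d j ^ 8"
      by (simp only: x_def power_mult_distrib power_mult[symmetric]) simp
    also have "\<dots> = (\<beta> * c / 16) ^ 4 * real (j + 1) ^ 2"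
      unfolding d8 by (simp add: field_simps power_add[symmetric] del: of_nat_add of_nat_Suc)
    also have "256 / \<dots> = M / 2 / \<beta> ^ 4 * (1 / real (j + 1) ^ 2)"
      using \<beta> c by (simp add: M_def power_mult_distrib power_divide field_simps)
    also have "\<dots> \<le> M / 2 / \<beta> * (1 / real (j + 1) ^ 2)"
      using \<beta> M by (intro mult_right_mono divide_left_mono self_le_power) auto
    finally have *: "exp (- (\<beta> / 2 * lam N j) * (d j)\<^sup>2 / 2) \<le> M / 2 / \<beta> * (1 / real (j + 1) ^ 2)" .
    have "sqrt 2 * exp (- (\<beta> / 2 * lam N j) * (d j)\<^sup>2 / 2) \<le> 2 * (M / 2 / \<beta> * (1 / real (j + 1) ^ 2))"
      using * sqrt2_less_2 by (intro mult_mono) auto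
    then show ?thesis by simp
  qed
  have main: "(LINT b:coord_box d N|lebesgue_N N. exp (- (\<beta> / 2) * (\<Sum>j=1..N. lam N j * (b j)\<^sup>2))) /
      (LINT b|lebesgue_N N. exp (- (\<beta> / 2) * (\<Sum>j=1..N. lam N j * (b j)\<^sup>2))) > 1 - \<epsilon>"
    if \<beta>: "\<beta> > \<beta>1" for \<beta> N
  proof -
    have \<beta>': "\<beta> > 1" "M * S / \<epsilon> < \<beta>"
      using \<beta> by (auto simp: \<beta>1_def)
    have pos: "\<beta> / 2 * lam N j > 0" if "j \<in> {1..N}" for j
    proof -
      have "0 < c * (real j)\<^sup>2" using c that by simp
      then show ?thesis using c(2)[OF that] \<beta>' by simp
    qed
    have "(\<Sum>j=1..N. sqrt 2 * exp (- (\<beta> / 2 * lam N j) * (d j)\<^sup>2 / 2))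
        \<le> (\<Sum>j=1..N. M / \<beta> * (1 / real (j + 1) ^ 2))"
      using tail \<beta>' by (intro sum_mono) auto
    also have "\<dots> = M / \<beta> * (\<Sum>j=1..N. 1 / real (j + 1) ^ 2)"
      by (simp only: sum_distrib_left)
    also have "\<dots> \<le> M / \<beta> * S"
      unfolding S_def using M \<beta>' by (intro mult_left_mono sum_le_suminf summ) auto
    also have "\<dots> < \<epsilon>"
      using \<beta>' \<open>\<epsilon> > 0\<close> by (simp add: field_simps)
    finally have "1 - \<epsilon> < 1 - (\<Sum>j=1..N. sqrt 2 * exp (- (\<beta> / 2 * lam N j) * (d j)\<^sup>2 / 2))"
      by simp
    also note gaussian_box_ratio[of N "\<lambda>j. \<beta> / 2 * lam N j" d, OF pos d]
    finally show ?thesis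
      by (simp add: sum_distrib_left sum_negf mult.assoc)
  qed
  show ?thesis
    using d \<open>summable (\<lambda>j. (d j)\<^sup>2)\<close> main by (intro exI[of _ \<beta>1] conjI exI[of _ d]) (auto simp: \<beta>1_def)
qed

section \<open>A quadratic eigenvalue bound uniform in N, and the concentration estimate\<close>

theorem proposition2:
  fixes V V' V'' :: "real \<Rightarrow> real" and \<delta> C \<delta>hat :: real and bc :: boundary
    and u :: "well \<Rightarrow> nat \<Rightarrow> nat \<Rightarrow> real" and s :: well
    and lam :: "nat \<Rightarrow> nat \<Rightarrow> real" and \<psi> :: "nat \<Rightarrow> nat \<Rightarrow> nat \<Rightarrow> real"
  assumes "\<delta> > 0"
    and "\<And>x. (V has_real_derivative V' x) (at x)"
    and "\<And>x. (V' has_real_derivative V'' x) (at x)"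
    and "continuous_on UNIV V''"
    and "double_well V"
    and "bdd_below (range V)"
    and "\<exists>\<kappa>>0. \<exists>R. \<forall>x. \<bar>x\<bar> \<ge> R \<longrightarrow> V x \<ge> \<kappa> * x\<^sup>2"
    and "\<And>N \<sigma>. N > 0 \<Longrightarrow> minimizer N (potential_energy V \<delta> bc N) (u \<sigma> N)"
    and "\<And>N. N > 0 \<Longrightarrow> \<exists>j\<in>{1..N}. u Plus N j \<noteq> u Minus N j"
    and "\<And>N k. k \<in> {1..N} \<Longrightarrow> hessian_eigenpair V'' \<delta> bc N (u s N) (lam N k) (\<psi> N k)"
    and "\<And>N j k. 1 \<le> j \<Longrightarrow> j < k \<Longrightarrow> k \<le> N \<Longrightarrow> lam N j < lam N k"
    and "\<exists>m>0. \<forall>N. \<forall>k\<in>{1..N}. lam N k \<ge> m"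
    and "C > 0"
    and "\<And>\<epsilon>. \<epsilon> > 0 \<Longrightarrow>
      \<forall>\<^sub>F j in sequentially. \<forall>\<^sub>F N in sequentially. \<bar>lam N j / (C * (real j)\<^sup>2) - 1\<bar> < \<epsilon>"
    and "\<delta>hat > 0"
  shows "\<exists>\<beta>1>0. \<exists>d :: nat \<Rightarrow> real. (\<forall>j. d j > 0) \<and> summable (\<lambda>j. (d j)\<^sup>2) \<and>
    (\<forall>\<beta>>\<beta>1. \<forall>N>0.
      (LINT b:coord_box d N|lebesgue_N N. exp (- (\<beta> / 2) * (\<Sum>j=1..N. lam N j * (b j)\<^sup>2))) /
      (LINT b|lebesgue_N N. exp (- (\<beta> / 2) * (\<Sum>j=1..N. lam N j * (b j)\<^sup>2)))
      > 1 - \<delta>hat)"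
proof -
  have "continuous_on UNIV V"
    using assms(2) by (intro DERIV_continuous_on) (auto intro: DERIV_subset)
  then obtain B where B: "\<And>N \<delta> bc u j. N > 0 \<Longrightarrow> minimizer N (potential_energy V \<delta> bc N) u \<Longrightarrow>
      j \<in> {1..N} \<Longrightarrow> \<bar>u j\<bar> \<le> B"
    using minimizers_uniformly_bounded[OF _ assms(5,7)] by blast
  \<comment> \<open>As \<open>B\<close> is the same for all N, one constant \<open>K\<close> serves
    along all the minimizers.\<close>
  have "bounded (V'' ` {- B..B})"
    using assms(4) by (intro compact_imp_bounded compact_continuous_image) (auto intro: continuous_on_subset)
  then obtain K where K: "K > 0" "\<And>x. x \<in> {- B..B} \<Longrightarrow> \<bar>V'' x\<bar> \<le> K"
    by (auto simp: bounded_pos)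
  obtain m where m: "m > 0" "\<And>N k. k \<in> {1..N} \<Longrightarrow> lam N k \<ge> m"
    using assms(12) by blast
  \<comment> \<open>The weight for which the convex combination of the bounds \<delta>^2 k^2 / 32 -
    K and m loses its constant term: -\<theta> K + (1 - \<theta>) m = 0.\<close>
  define \<theta> where "\<theta> = m / (m + K)"
  have \<theta>: "0 < \<theta>" "\<theta> \<le> 1" "\<theta> * (m + K) = m"
    using m(1) K(1) by (auto simp: \<theta>_def)
  \<comment> \<open>The entry m / 4 covers k <= 2, where k^2 <= 4.\<close>
  define c where "c = min (m / 4) (\<theta> * (\<delta>\<^sup>2 / 32))"
  have "c > 0"
    using m(1) \<theta>(1) \<open>\<delta> > 0\<close> by (simp add: c_def)
  have lower: "c * (real k)\<^sup>2 \<le> lam N k" if k: "k \<in> {1..N}" for N k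
  proof (cases "k \<le> 2")
    case True
    have "c * (real k)\<^sup>2 \<le> m / 4 * 2\<^sup>2"
      using True m(1) by (intro mult_mono power_mono) (auto simp: c_def)
    also have "\<dots> \<le> lam N k"
      using m(2)[OF k] by simp
    finally show ?thesis .
  next
    case False
    have "V'' (u s N j) \<ge> - K" if "j \<in> {1..N}" for j
      using K(2)[of "u s N j"] B[OF _ assms(8) that, of s] that by (simp add: abs_le_iff)
    then have "\<delta>\<^sup>2 / 32 * (real k)\<^sup>2 - K \<le> lam N k"
      using False k
      by (intro hessian_eigenvalue_lower_bound[where \<psi> = "\<psi> N" and u = "u s N" and bc = bc and W = V''])
        (auto intro!: assms(10,11))
    then have "\<theta> * (\<delta>\<^sup>2 / 32 * (real k)\<^sup>2 - K) + (1 - \<theta>) * m \<le> \<theta> * lam N k + (1 - \<theta>) * lam N k"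
      using \<theta> m(2)[OF k] by (intro add_mono mult_left_mono) auto
    then have "\<theta> * (\<delta>\<^sup>2 / 32) * (real k)\<^sup>2 \<le> lam N k"
      using \<theta>(3) by (simp add: algebra_simps)
    moreover have "c * (real k)\<^sup>2 \<le> \<theta> * (\<delta>\<^sup>2 / 32) * (real k)\<^sup>2"
      by (intro mult_right_mono) (auto simp: c_def)
    ultimately show ?thesis
      by linarith
  qed
  show ?thesis
    by (rule gaussian_box_ratio_tendsto_1_uniformly[OF \<open>c > 0\<close> lower assms(15)])
qed

end
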